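(* Let $G=(V,E,m,w)$ be a weighted graph with bounded geometry. If $G$ has nonnegative Ollivier curvature outside $B_{R_0}(x_0)$ for some $x_0\in V$ and $R_0\in\mathbb{N}$, then $$\dim \mathcal{H}_0(G)\leq \sharp S_{R_0+1}(x_0)<\infty .$$
   Context: A weighted graph $G=(V,E,m,w)$ consists of a locally finite, simple, undirected, connected graph $(V,E)$, an edge weight $w:E\to(0,\infty)$, $w(x,y)=w(y,x)$, and a vertex weight $m:V\to(0,\infty)$. We write $x\sim y$ if $\{x,y\}\in E$, $\deg(x)=\sharp\{y\in V: y\sim x\}$, $d$ for the combinatorial graph distance, $B_R(x)=\{y\in V: d(y,x)\le R\}$, $S_R(x)=\{y\in V: d(y,x)=R\}$; $\sharp$ denotes the cardinality of a set. Bounded geometry: there is a constant $C>0$ with $\deg(x)\le C$ and $C^{-1}\le m(x)\le C$ for all $x\in V$, and $C^{-1}\le w(x,y)\le C$ for all $x,y\in V$ with $x\sim y$. The Laplacian is $\Delta f(x)=\sum_{y\sim x}\frac{w(x,y)}{m(x)}(f(y)-f(x))$ for $f:V\to\mathbb{R}$. $\mathcal{H}_0(G)$ is the real vector space of bounded functions $f:V\to\mathbb{R}$ with $\Delta f=0$ on $V$ (bounded harmonic functions). For $x\ne y$ in $V$ and $f:V\to\mathbb{R}$ put $\nabla_{xy}f=\frac{f(x)-f(y)}{d(x,y)}$ and $|\nabla f|_\infty=\sup_{x\sim y}\nabla_{xy}f$. The Ollivier curvature is $$\kappa(x,y)=\inf\{\nabla_{xy}\Delta f:\ f:V\to\mathbb{R},\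 \nabla_{yx}f=1,\ |\nabla f|_\infty=1\}.$$ For a finite $\Omega\subset V$, $G$ has nonnegative Ollivier curvature outside $\Omega$ if $\kappa(x,y)\ge 0$ for every edge $\{x,y\}\in E$ with $x,y\in V\setminus\Omega$.
   Formalization: The sphere S_{R_0+1}(x_0) is additionally assumed nonempty (automatic for infinite V); if it is empty then V = B_{R_0}(x_0) is finite and the constants give dim H_0 ≥ 1 > 0, so the claim fails. *)

theory Defs
  imports "HOL-Analysis.Analysis" "HOL-Library.Function_Algebras"
begin

text \<open>The vertex set is the whole type \<^typ>\<open>'a\<close>; an edge \<open>{x, y}\<close> is a pair with \<open>adj x y\<close>.
  The edge weight \<open>w\<close> is only ever evaluated at adjacent pairs; its other values are irrelevant.\<close>

locale weighted_graph =
  fixes adj :: "'a \<Rightarrow> 'a \<Rightarrow> bool" and m :: "'a \<Rightarrow> real" and w :: "'a \<Rightarrow> 'a \<Rightarrow> real"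
  assumes adj_irrefl: "\<not> adj x x"
    and adj_sym: "adj x y \<Longrightarrow> adj y x"
    and locally_finite: "finite {y. adj x y}"
    and adj_connected: "adj\<^sup>*\<^sup>* x y"
    and w_pos: "adj x y \<Longrightarrow> 0 < w x y"
    and w_sym: "adj x y \<Longrightarrow> w x y = w y x"
    and m_pos: "0 < m x"

definition vertex_degree :: "('a \<Rightarrow> 'a \<Rightarrow> bool) \<Rightarrow> 'a \<Rightarrow> nat" where
  "vertex_degree adj x = card {y. adj x y}"

text \<open>\<open>(adj ^^ n) x y\<close> says that there is a walk of length \<open>n\<close> from \<open>x\<close> to \<open>y\<close>.\<close>

definition graph_dist :: "('a \<Rightarrow> 'a \<Rightarrow> bool) \<Rightarrow> 'a \<Rightarrow> 'a \<Rightarrow> nat" where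
  "graph_dist adj x y = (LEAST n. (adj ^^ n) x y)"

definition graph_ball :: "('a \<Rightarrow> 'a \<Rightarrow> bool) \<Rightarrow> 'a \<Rightarrow> nat \<Rightarrow> 'a set" where
  "graph_ball adj x R = {y. graph_dist adj y x \<le> R}"

definition graph_sphere :: "('a \<Rightarrow> 'a \<Rightarrow> bool) \<Rightarrow> 'a \<Rightarrow> nat \<Rightarrow> 'a set" where
  "graph_sphere adj x R = {y. graph_dist adj y x = R}"

definition bounded_geometry ::
    "('a \<Rightarrow> 'a \<Rightarrow> bool) \<Rightarrow> ('a \<Rightarrow> real) \<Rightarrow> ('a \<Rightarrow> 'a \<Rightarrow> real) \<Rightarrow> bool" where
  "bounded_geometry adj m w \<longleftrightarrow>
     (\<exists>C>0. (\<forall>x. real (vertex_degree adj x) \<le> C \<and> inverse C \<le> m x \<and> m x \<le> C) \<and>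
            (\<forall>x y. adj x y \<longrightarrow> inverse C \<le> w x y \<and> w x y \<le> C))"

definition laplacian ::
    "('a \<Rightarrow> 'a \<Rightarrow> bool) \<Rightarrow> ('a \<Rightarrow> real) \<Rightarrow> ('a \<Rightarrow> 'a \<Rightarrow> real) \<Rightarrow> ('a \<Rightarrow> real) \<Rightarrow> 'a \<Rightarrow> real" where
  "laplacian adj m w f x = (\<Sum>y\<in>{y. adj x y}. w x y / m x * (f y - f x))"

definition bounded_harmonic ::
    "('a \<Rightarrow> 'a \<Rightarrow> bool) \<Rightarrow> ('a \<Rightarrow> real) \<Rightarrow> ('a \<Rightarrow> 'a \<Rightarrow> real) \<Rightarrow> ('a \<Rightarrow> real) set" where
  "bounded_harmonic adj m w = {f. bounded (range f) \<and> (\<forall>x. laplacian adj m w f x = 0)}"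

definition gradient :: "('a \<Rightarrow> 'a \<Rightarrow> bool) \<Rightarrow> 'a \<Rightarrow> 'a \<Rightarrow> ('a \<Rightarrow> real) \<Rightarrow> real" where
  "gradient adj x y f = (f x - f y) / real (graph_dist adj x y)"

text \<open>The supremum and the infimum below are taken in the extended reals, so that a function with
  unbounded gradient gets norm \<open>\<infinity>\<close> and not an unspecified real number.\<close>

definition gradient_norm :: "('a \<Rightarrow> 'a \<Rightarrow> bool) \<Rightarrow> ('a \<Rightarrow> real) \<Rightarrow> ereal" where
  "gradient_norm adj f = (SUP (x, y)\<in>{(x, y). adj x y}. ereal (gradient adj x y f))"

definition ollivier_curvature ::
    "('a \<Rightarrow> 'a \<Rightarrow> bool) \<Rightarrow> ('a \<Rightarrow> real) \<Rightarrow> ('a \<Rightarrow> 'a \<Rightarrow> real) \<Rightarrow> 'a \<Rightarrow> 'a \<Rightarrow> ereal" where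
  "ollivier_curvature adj m w x y =
     (INF f\<in>{f. gradient adj y x f = 1 \<and> gradient_norm adj f = 1}.
        ereal (gradient adj x y (laplacian adj m w f)))"

definition nonneg_curvature_outside ::
    "('a \<Rightarrow> 'a \<Rightarrow> bool) \<Rightarrow> ('a \<Rightarrow> real) \<Rightarrow> ('a \<Rightarrow> 'a \<Rightarrow> real) \<Rightarrow> 'a set \<Rightarrow> bool" where
  "nonneg_curvature_outside adj m w \<Omega> \<longleftrightarrow>
     (\<forall>x y. adj x y \<and> x \<notin> \<Omega> \<and> y \<notin> \<Omega> \<longrightarrow> 0 \<le> ollivier_curvature adj m w x y)"

definition fun_scale :: "real \<Rightarrow> ('a \<Rightarrow> real) \<Rightarrow> 'a \<Rightarrow> real" where
  "fun_scale c f = (\<lambda>x. c * f x)"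

interpretation rfun: vector_space fun_scale
  by unfold_locales (auto simp: fun_scale_def fun_eq_iff algebra_simps)

text \<open>The library's \<open>dim\<close> is \<open>0\<close> on infinite-dimensional spaces, so an upper bound on it is only
  meaningful together with the following condition.\<close>

definition finite_dimensional :: "('a \<Rightarrow> real) set \<Rightarrow> bool" where
  "finite_dimensional H \<longleftrightarrow> (\<exists>B. finite B \<and> rfun.span B = H)"

text \<open>\<open>rfun.dim\<close> of a set is the dimension of its span; the next lemma shows that the bounded harmonic
  functions are their own span.\<close>

lemma subspace_bounded_harmonic: "rfun.subspace (bounded_harmonic adj m w)"
proof -
  have lap_add: "laplacian adj m w (f + g) x = laplacian adj m w f x + laplacian adj m w g x" for f g x
    by (simp add: laplacian_def ring_distribs flip: sum.distrib) (simp add: algebra_simps)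
  have lap_scale: "laplacian adj m w (fun_scale c f) x = c * laplacian adj m w f x" for c f x
    by (simp add: laplacian_def fun_scale_def sum_distrib_left algebra_simps diff_divide_distrib)
  have "bounded (range (f + g))" if "bounded (range f)" "bounded (range g)" for f g :: "'a \<Rightarrow> real"
    using bounded_plus_comp[OF that] by (simp add: plus_fun_def)
  moreover have "bounded (range (fun_scale c f))" if "bounded (range f)" for c and f :: "'a \<Rightarrow> real"
    using bounded_scaling[OF that, of c] by (simp add: fun_scale_def image_image)
  moreover have "(0 :: 'a \<Rightarrow> real) \<in> bounded_harmonic adj m w"
    by (auto simp: bounded_harmonic_def laplacian_def bounded_iff)
  ultimately show ?thesis
    unfolding rfun.subspace_def
    by (auto simp: bounded_harmonic_def lap_add lap_scale)
qed

end

theory Submission imports Defs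
begin

text \<open>
  A bounded harmonic function that vanishes on the sphere of radius \<open>R\<^sub>0 + 1\<close> vanishes everywhere
  (lemma \<open>bounded_harmonic_eq_0\<close>). Hence restriction to that finite sphere is an injective linear
  map on the bounded harmonic functions, and their dimension is at most the size of the sphere
  (lemma \<open>dim_le_card_of_determining_set\<close>).

  Let \<open>f\<close> be bounded and harmonic with zero values on the sphere. By the maximum principle \<open>f\<close> is
  zero on the ball of radius \<open>R\<^sub>0 + 1\<close>, so every edge along which \<open>f\<close> changes has both endpoints
  outside the ball of radius \<open>R\<^sub>0\<close>, where the curvature is nonnegative. If \<open>f\<close> is not zero, scale it
  so that the supremum of \<open>f y - f x\<close> over all edges is 1. Call an edge from \<open>x\<close> up to \<open>y\<close> steep
  if \<open>f y - f x \<ge> 1 - \<epsilon>\<close>.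

  The top \<open>y\<close> of a steep edge has, by harmonicity, a neighbour \<open>z\<close> at which \<open>f\<close> is larger by a fixed
  amount \<open>\<delta>\<close> (lemma \<open>harmonic_increases\<close>). The curvature condition forces \<open>z\<close> to be the top of
  an edge that is again steep, with \<open>\<epsilon>\<close> enlarged by a constant factor (lemma
  \<open>steep_edge_propagates\<close>): otherwise \<open>f\<close> could be raised at \<open>z\<close> without violating the Lipschitz
  bound, and this would make its Laplacian at \<open>y\<close> exceed the one at \<open>x\<close>. Starting from an edge that
  is steep enough, any number of such steps can be made, and each raises \<open>f\<close> by \<open>\<delta>\<close>; this
  contradicts boundedness. Working with almost extremal edges replaces a compactness argument
  along translates of the graph, and testing the curvature against an explicit perturbation
  of \<open>f\<close> avoids any use of transport duality.
\<close>

context weighted_graph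
begin

section \<open>Graph distance and balls\<close>

lemma graph_dist_walk: "(adj ^^ graph_dist adj x y) x y"
  unfolding graph_dist_def
  by (rule LeastI_ex) (use adj_connected[of x y] in \<open>simp add: rtranclp_is_Sup_relpowp\<close>)

lemma graph_dist_le: "(adj ^^ n) x y \<Longrightarrow> graph_dist adj x y \<le> n"
  unfolding graph_dist_def by (rule Least_le)

lemma graph_dist_self [simp]: "graph_dist adj x x = 0"
  using graph_dist_le[of 0 x x] by simp

lemma graph_dist_eq_0_iff [simp]: "graph_dist adj x y = 0 \<longleftrightarrow> x = y"
  using graph_dist_walk[of x y] by auto

lemma graph_dist_adj: "adj x y \<Longrightarrow> graph_dist adj x y = 1"
proof -
  assume xy: "adj x y"
  then have "x \<noteq> y" using adj_irrefl by blast
  moreover have "graph_dist adj x y \<le> 1"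
    by (rule graph_dist_le) (use xy in \<open>simp add: eq_OO\<close>)
  ultimately show ?thesis
    using graph_dist_eq_0_iff[of x y] by linarith
qed

lemma graph_dist_adj_step: "adj u v \<Longrightarrow> graph_dist adj u p \<le> graph_dist adj v p + 1"
  using graph_dist_le[OF relpowp_Suc_I2[OF _ graph_dist_walk]] by (metis Suc_eq_plus1)

lemma graph_ball_adj: "adj u v \<Longrightarrow> u \<in> graph_ball adj x R \<Longrightarrow> v \<in> graph_ball adj x (R + 1)"
  using graph_dist_adj_step[of v u x] adj_sym[of u v] by (simp add: graph_ball_def)

lemma finite_graph_ball: "finite (graph_ball adj x R)"
proof (induction R)
  case 0
  then show ?case by (simp add: graph_ball_def)
next
  case (Suc R)
  have "graph_ball adj x (Suc R) \<subseteq> graph_ball adj x R \<union> (\<Union>v\<in>graph_ball adj x R. {u. adj v u})"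
  proof
    fix u assume "u \<in> graph_ball adj x (Suc R)"
    then have u: "graph_dist adj u x \<le> Suc R" by (simp add: graph_ball_def)
    show "u \<in> graph_ball adj x R \<union> (\<Union>v\<in>graph_ball adj x R. {u. adj v u})"
    proof (cases "graph_dist adj u x")
      case 0
      then show ?thesis by (simp add: graph_ball_def)
    next
      case (Suc k)
      then obtain v where "adj u v" "(adj ^^ k) v x"
        using graph_dist_walk[of u x] by (metis relpowp_Suc_D2)
      then show ?thesis
        using graph_dist_le[of k v x] Suc u adj_sym[of u v] by (auto simp: graph_ball_def)
    qed
  qed
  then show ?case
    by (rule finite_subset) (use Suc locally_finite in auto)
qed

lemma finite_graph_sphere: "finite (graph_sphere adj x R)"
  by (rule finite_subset[OF _ finite_graph_ball[of x R]]) (auto simp: graph_sphere_def graph_ball_def)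

lemma lipschitz_walk:
  fixes f :: "'a \<Rightarrow> real"
  assumes lip: "\<And>u v. adj u v \<Longrightarrow> f v - f u \<le> 1"
  shows "(adj ^^ n) u p \<Longrightarrow> f p - f u \<le> real n"
proof (induction n arbitrary: p)
  case 0
  then show ?case by simp
next
  case (Suc n)
  then obtain q where q: "(adj ^^ n) u q" "adj q p" by auto
  show ?case using Suc.IH[OF q(1)] lip[OF q(2)] by simp
qed

section \<open>Harmonic functions\<close>

lemma harmonic_max_neighbour:
  assumes harm: "laplacian adj m w f x = 0"
    and le: "\<And>y. adj x y \<Longrightarrow> f y \<le> f x" and y: "adj x y"
  shows "f y = f x"
proof -
  have "(\<Sum>y\<in>{y. adj x y}. w x y / m x * (f x - f y)) = 0"
    using harm by (simp add: laplacian_def right_diff_distrib sum_subtractf)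
  moreover have "0 \<le> w x y / m x * (f x - f y)" if "y \<in> {y. adj x y}" for y
    using that le[of y] w_pos[of x y] m_pos[of x] by (simp add: zero_le_mult_iff)
  ultimately have "w x y / m x * (f x - f y) = 0"
    using locally_finite[of x] y by (subst (asm) sum_nonneg_eq_0_iff) auto
  then show ?thesis
    using w_pos[OF y] m_pos[of x] by auto
qed

text \<open>The maximum principle on the ball. The graph may continue outside the ball, but any walk
  from a point of the ball to the sphere stays in the ball until it first meets the sphere.\<close>

lemma harmonic_nonpos_ball:
  assumes harm: "\<And>x. laplacian adj m w f x = 0"
    and zero: "\<And>x. x \<in> graph_sphere adj x0 (R + 1) \<Longrightarrow> f x = 0"
    and s: "s \<in> graph_sphere adj x0 (R + 1)"
    and v: "v \<in> graph_ball adj x0 (R + 1)"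
  shows "f v \<le> 0"
proof (rule ccontr)
  assume pos: "\<not> f v \<le> 0"
  let ?B = "graph_ball adj x0 (R + 1)"
  have fin: "finite (f ` ?B)" using finite_graph_ball by blast
  obtain p where p: "p \<in> ?B" "f p = Max (f ` ?B)"
    using Max_in[OF fin] v by (metis empty_iff image_iff)
  have max: "f u \<le> f p" if "u \<in> ?B" for u
    using Max_ge[OF fin] that p(2) by auto
  have fp: "f p > 0" using max[OF v] pos by linarith
  have "u \<in> ?B \<and> f u = f p" if "adj\<^sup>*\<^sup>* p u" for u
    using that
  proof (induction rule: rtranclp_induct)
    case base
    then show ?case using p by simp
  next
    case (step u t)
    then have "u \<notin> graph_sphere adj x0 (R + 1)" using zero fp by fastforce
    then have u: "u \<in> graph_ball adj x0 R"
      using step by (auto simp: graph_sphere_def graph_ball_def)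
    have "f t = f u"
      by (rule harmonic_max_neighbour[OF harm _ step(2)])
        (use step.IH max graph_ball_adj[OF _ u] in auto)
    then show ?case using step graph_ball_adj[OF _ u] by simp
  qed
  from this[OF adj_connected[of p s]] show False using zero[OF s] fp by simp
qed

lemma laplacian_scale: "laplacian adj m w (\<lambda>v. c * f v) x = c * laplacian adj m w f x"
  by (simp add: laplacian_def sum_distrib_left algebra_simps diff_divide_distrib)

lemma harmonic_zero_ball:
  assumes harm: "\<And>x. laplacian adj m w f x = 0"
    and zero: "\<And>x. x \<in> graph_sphere adj x0 (R + 1) \<Longrightarrow> f x = 0"
    and s: "s \<in> graph_sphere adj x0 (R + 1)"
    and v: "v \<in> graph_ball adj x0 (R + 1)"
  shows "f v = 0"
proof -
  have "f v \<le> 0" by (rule harmonic_nonpos_ball[OF assms])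
  moreover have "(-1) * f v \<le> 0"
    by (rule harmonic_nonpos_ball[where f = "\<lambda>v. (-1) * f v", OF _ _ s v])
      (simp only: laplacian_scale harm mult_zero_right, simp add: zero)
  ultimately show ?thesis by simp
qed

section \<open>Steep edges\<close>

text \<open>For functions that are 1-Lipschitz along edges and attain the bound on the edge from \<open>x\<close> to
  \<open>y\<close>, the gradient norm is exactly 1, so they compete in the infimum that defines the
  curvature.\<close>

lemma nonneg_curvature_laplacian_le:
  assumes xy: "adj x y" and curv: "0 \<le> ollivier_curvature adj m w x y"
    and lip: "\<And>u v. adj u v \<Longrightarrow> g v - g u \<le> 1" and g: "g y - g x = 1"
  shows "laplacian adj m w g y \<le> laplacian adj m w g x"
proof -
  have grad: "gradient adj u v h = h u - h v" if "adj u v" for u v h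
    using graph_dist_adj[OF that] by (simp add: gradient_def)
  have 1: "gradient adj y x g = 1" using grad[OF adj_sym[OF xy]] g by simp
  have "gradient_norm adj g \<le> 1"
    unfolding gradient_norm_def by (rule SUP_least) (use grad lip adj_sym in auto)
  moreover have "1 \<le> gradient_norm adj g"
    unfolding gradient_norm_def
    by (rule SUP_upper2[of "(y, x)"]) (use adj_sym[OF xy] 1 in auto)
  ultimately have "gradient_norm adj g = 1" by simp
  then have "ollivier_curvature adj m w x y \<le> ereal (gradient adj x y (laplacian adj m w g))"
    unfolding ollivier_curvature_def using 1 by (intro INF_lower) auto
  then have "0 \<le> gradient adj x y (laplacian adj m w g)"
    using curv order_trans ereal_less_eq(5) by blast
  then show ?thesis using grad[OF xy] by simp
qed

text \<open>The constants \<open>a\<close> and \<open>D\<close> bound the transition rates \<open>w u v / m u\<close> from below and the total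
  rate at a vertex from above. The loss of steepness from \<open>\<epsilon>\<close> to \<open>\<eta>\<close> is governed by their ratio.\<close>

lemma steep_edge_propagates:
  fixes f :: "'a \<Rightarrow> real"
  assumes harm: "\<And>x. laplacian adj m w f x = 0"
    and lip: "\<And>u v. adj u v \<Longrightarrow> f v - f u \<le> 1"
    and lower: "\<And>u v. adj u v \<Longrightarrow> a \<le> w u v / m u"
    and total: "\<And>u. (\<Sum>v\<in>{v. adj u v}. w u v / m u) \<le> D"
    and xy: "adj x y" and curv: "0 \<le> ollivier_curvature adj m w x y"
    and steep: "1 - \<epsilon> \<le> f y - f x"
    and yz: "adj y z" and up: "f y + \<epsilon> < f z"
    and \<eta>: "0 \<le> \<eta>" "2 * D * \<epsilon> < a * \<eta>"
  shows "\<exists>z'. adj z' z \<and> 1 - \<eta> < f z - f z'"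
proof (rule ccontr)
  assume "\<not> ?thesis"
  then have flat: "f z - f z' \<le> 1 - \<eta>" if "adj z' z" for z' using that by force
  have q_pos: "0 < w u v / m u" if "adj u v" for u v using w_pos[OF that] m_pos[of u] by simp
  \<comment> \<open>The competitor \<open>g\<close> is the least 1-Lipschitz function above \<open>f\<close> with \<open>g y \<ge> f y + e\<close> and
    \<open>g z \<ge> f z + \<eta>\<close>. The rise \<open>e\<close> at \<open>y\<close> makes the edge from \<open>x\<close> to \<open>y\<close> exactly extremal; it costs
    at most \<open>D * e\<close> in the Laplacian at each of \<open>x\<close> and \<open>y\<close>, while the rise \<open>\<eta>\<close> at \<open>z\<close> gains at
    least \<open>a * \<eta>\<close> at \<open>y\<close> and nothing at \<open>x\<close>.\<close>
  define e where "e = 1 - (f y - f x)"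
  have e: "0 \<le> e" "e \<le> \<epsilon>" using lip[OF xy] steep by (auto simp: e_def)
  define d where "d u v = real (graph_dist adj u v)" for u v
  define g where "g v = max (f v) (max (f y + e - d v y) (f z + \<eta> - d v z))" for v
  have f_lip: "f p - d u p \<le> f u" for u p
    using lipschitz_walk[of f, OF lip graph_dist_walk[of u p]] by (simp add: d_def)
  \<comment> \<open>Since all edges below \<open>z\<close> leave room \<open>\<eta>\<close>, the rise at \<open>z\<close> is not felt at any other vertex.\<close>
  have far: "f z + \<eta> - d u z \<le> f u" if uz: "u \<noteq> z" for u
  proof -
    obtain k where k: "graph_dist adj u z = Suc k"
      using uz by (cases "graph_dist adj u z") auto
    then obtain q where q: "(adj ^^ k) u q" "adj q z"
      using graph_dist_walk[of u z] by auto
    show ?thesis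
      using lipschitz_walk[of f, OF lip q(1)] flat[OF q(2)] k by (simp add: d_def)
  qed
  have zx: "z \<noteq> x" "\<not> adj x z" "z \<noteq> y"
    using up steep lip[of x z] e by force+
  have gy: "g y = f y + e"
    using far[of y] zx e by (simp add: g_def d_def)
  have gx: "g x = f x"
    using far[of x] zx graph_dist_adj[OF xy] by (simp add: g_def d_def e_def)
  have d_step: "d u p \<le> d v p + 1" if "adj u v" for u v p
    using graph_dist_adj_step[OF that, of p] by (simp add: d_def)
  have g_lip: "g v - g u \<le> 1" if "adj u v" for u v
    using lip[OF that] d_step[OF that, of y] d_step[OF that, of z] by (simp add: g_def)
  have le: "laplacian adj m w g y \<le> laplacian adj m w g x"
    by (rule nonneg_curvature_laplacian_le[OF xy curv g_lip]) (simp_all add: gx gy e_def)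
  have "laplacian adj m w g x
      \<le> (\<Sum>v\<in>{v. adj x v}. w x v / m x * (f v - f x) + w x v / m x * e)"
    unfolding laplacian_def
  proof (rule sum_mono)
    fix v assume "v \<in> {v. adj x v}"
    then have v: "adj x v" by simp
    then have "g v \<le> f v + e"
      using far[of v] zx(2) v e f_lip[of y v] by (cases "v = z") (auto simp: g_def)
    then have "w x v / m x * (g v - g x) \<le> w x v / m x * (f v - f x + e)"
      using q_pos[OF v] gx by (intro mult_left_mono) auto
    then show "w x v / m x * (g v - g x) \<le> w x v / m x * (f v - f x) + w x v / m x * e"
      by (simp only: distrib_left)
  qed
  also have "\<dots> = (\<Sum>v\<in>{v. adj x v}. w x v / m x) * e"
    using harm[of x] by (simp only: sum.distrib laplacian_def sum_distrib_right)
  also have "\<dots> \<le> D * e" using total e by (intro mult_right_mono)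
  finally have upper: "laplacian adj m w g x \<le> D * e" .
  let ?b = "\<lambda>v. if v = z then w y v / m y * \<eta> else 0"
  have "a * \<eta> - D * e \<le> w y z / m y * \<eta> - (\<Sum>v\<in>{v. adj y v}. w y v / m y) * e"
    using lower[OF yz] total[of y] e \<eta> by (intro diff_mono mult_right_mono)
  also have "\<dots> = (\<Sum>v\<in>{v. adj y v}. w y v / m y * (f v - f y) - w y v / m y * e + ?b v)"
    using harm[of y] locally_finite[of y] yz
    by (simp only: sum.distrib sum_subtractf laplacian_def sum_distrib_right) (simp add: sum.delta)
  also have "\<dots> \<le> laplacian adj m w g y"
    unfolding laplacian_def
  proof (rule sum_mono)
    fix v assume "v \<in> {v. adj y v}"
    then have v: "adj y v" by simp
    have "f v + (if v = z then \<eta> else 0) \<le> g v" by (auto simp: g_def d_def)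
    then have "w y v / m y * (f v - f y - e + (if v = z then \<eta> else 0)) \<le> w y v / m y * (g v - g y)"
      using q_pos[OF v] gy by (intro mult_left_mono) auto
    then show "w y v / m y * (f v - f y) - w y v / m y * e + ?b v \<le> w y v / m y * (g v - g y)"
      by (simp add: algebra_simps diff_divide_distrib add_divide_distrib split: if_splits)
  qed
  finally have "a * \<eta> \<le> 2 * (D * e)" using le upper by linarith
  moreover have "0 \<le> D"
    using total[of x] sum_nonneg[of "{v. adj x v}" "\<lambda>v. w x v / m x"] q_pos by force
  then have "D * e \<le> D * \<epsilon>" using e by (intro mult_left_mono)
  ultimately show False using \<eta> by linarith
qed

lemma harmonic_increases:
  assumes harm: "laplacian adj m w f y = 0"
    and lower: "a \<le> w y x / m y"
    and total: "(\<Sum>v\<in>{v. adj y v}. w y v / m y) \<le> D"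
    and xy: "adj y x" and steep: "1 / 2 \<le> f y - f x"
    and \<delta>: "0 \<le> \<delta>" "2 * D * \<delta> < a"
  shows "\<exists>z. adj y z \<and> f y + \<delta> < f z"
proof (rule ccontr)
  assume "\<not> ?thesis"
  then have flat: "f z - f y \<le> \<delta>" if "adj y z" for z using that by force
  have q_pos: "0 < w y v / m y" if "adj y v" for v using w_pos[OF that] m_pos[of y] by simp
  let ?b = "\<lambda>v. if v = x then w y v / m y * (1/2) else 0"
  have "laplacian adj m w f y \<le> (\<Sum>v\<in>{v. adj y v}. w y v / m y * \<delta> - ?b v)"
    unfolding laplacian_def
  proof (rule sum_mono)
    fix v assume "v \<in> {v. adj y v}"
    then have v: "adj y v" by simp
    have "w y v / m y * (f v - f y) \<le> w y v / m y * (\<delta> - (if v = x then 1/2 else 0))"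
      using flat[OF v] steep \<delta> q_pos[OF v] by (intro mult_left_mono) auto
    then show "w y v / m y * (f v - f y) \<le> w y v / m y * \<delta> - ?b v"
      by (simp add: algebra_simps split: if_splits)
  qed
  also have "\<dots> = (\<Sum>v\<in>{v. adj y v}. w y v / m y) * \<delta> - w y x / m y * (1/2)"
    using locally_finite[of y] xy by (simp only: sum_subtractf sum_distrib_right) (simp add: sum.delta)
  also have "\<dots> \<le> D * \<delta> - a * (1/2)"
    using lower total \<delta> by (intro diff_mono mult_right_mono) auto
  finally show False using harm \<delta> by linarith
qed

text \<open>A bounded harmonic function cannot have edges that come arbitrarily close to its Lipschitz
  bound: climbing from one steep edge to the next would make it unbounded.\<close>

lemma no_asymptotically_steep_edges:
  fixes f :: "'a \<Rightarrow> real"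
  assumes harm: "\<And>x. laplacian adj m w f x = 0"
    and bdd: "\<And>x. \<bar>f x\<bar> \<le> M"
    and lip: "\<And>u v. adj u v \<Longrightarrow> f v - f u \<le> 1"
    and a: "0 < a" and lower: "\<And>u v. adj u v \<Longrightarrow> a \<le> w u v / m u"
    and total: "\<And>u. (\<Sum>v\<in>{v. adj u v}. w u v / m u) \<le> D"
    and curv: "\<And>x y. adj x y \<Longrightarrow> 0 < f y - f x \<Longrightarrow> 0 \<le> ollivier_curvature adj m w x y"
    and steep: "\<And>\<epsilon>. 0 < \<epsilon> \<Longrightarrow> \<exists>x y. adj x y \<and> 1 - \<epsilon> \<le> f y - f x"
  shows False
proof -
  obtain x y where "adj x y" using steep[of 1] by auto
  then have "0 < D" using a lower[of x y] total[of x]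
      member_le_sum[of y "{v. adj x v}" "\<lambda>v. w x v / m x"] w_pos[of x] m_pos[of x] locally_finite[of x]
    by (force simp: less_imp_le)
  define \<delta> where "\<delta> = a / (4 * D)"
  have \<delta>: "0 < \<delta>" "2 * D * \<delta> < a" using \<open>0 < D\<close> a by (simp_all add: \<delta>_def)
  have climb: "\<exists>x y. adj x y \<and> 1 - \<epsilon> \<le> f y - f x \<and> - M + real n * \<delta> \<le> f y" if "0 < \<epsilon>" for n \<epsilon>
    using that
  proof (induction n arbitrary: \<epsilon>)
    case 0
    have "- M \<le> f y" for y using bdd[of y] by linarith
    then show ?case using steep[OF 0] by auto
  next
    case (Suc n)
    \<comment> \<open>The three bounds make the next edge \<open>\<epsilon>\<close>-steep, keep \<open>z\<close> more than \<open>\<epsilon>'\<close> above \<open>y\<close>, and make the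
      current edge steep enough to force the increase by \<open>\<delta>\<close>.\<close>
    define \<epsilon>' where "\<epsilon>' = min (a * \<epsilon> / (4 * D)) (min \<delta> (1 / 2))"
    have "\<epsilon>' > 0" using Suc.prems \<delta> a \<open>0 < D\<close> by (simp add: \<epsilon>'_def)
    have \<epsilon>'_le: "\<epsilon>' \<le> a * \<epsilon> / (4 * D)" "\<epsilon>' \<le> \<delta>" "\<epsilon>' \<le> 1 / 2" by (auto simp: \<epsilon>'_def)
    have "4 * D * \<epsilon>' \<le> a * \<epsilon>"
      using \<epsilon>'_le(1) \<open>0 < D\<close> by (simp add: field_simps)
    moreover have "0 < D * \<epsilon>'" using \<open>0 < D\<close> \<open>\<epsilon>' > 0\<close> by simp
    ultimately have \<epsilon>'_small: "2 * D * \<epsilon>' < a * \<epsilon>" by linarith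
    obtain x y where xy: "adj x y" "1 - \<epsilon>' \<le> f y - f x" "- M + real n * \<delta> \<le> f y"
      using Suc.IH[OF \<open>\<epsilon>' > 0\<close>] by blast
    have "1 / 2 \<le> f y - f x" using xy(2) \<epsilon>'_le(3) by linarith
    then obtain z where z: "adj y z" "f y + \<delta> < f z"
      using harmonic_increases[OF harm lower total adj_sym[OF xy(1)] _ _ \<delta>(2)] adj_sym[OF xy(1)] \<delta>(1)
      by fastforce
    have "0 \<le> ollivier_curvature adj m w x y"
      using curv[OF xy(1)] \<open>1 / 2 \<le> f y - f x\<close> by linarith
    then obtain z' where "adj z' z" "1 - \<epsilon> < f z - f z'"
      using steep_edge_propagates[OF harm lip lower total xy(1) _ xy(2) z(1) _ _ \<epsilon>'_small]
        z(2) \<epsilon>'_le(2) Suc.prems by auto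
    then show ?case
      using xy(3) z(2) by (intro exI[of _ z'] exI[of _ z]) (simp add: algebra_simps)
  qed
  obtain n where "2 * M < real n * \<delta>" using reals_Archimedean3[OF \<delta>(1)] by blast
  moreover obtain x y where "- M + real n * \<delta> \<le> f y" using climb[of 1 n] by auto
  ultimately show False using bdd[of y] by linarith
qed

lemma bounded_geometry_transition_bounds:
  assumes "bounded_geometry adj m w"
  obtains a D where "0 < a" "\<And>u v. adj u v \<Longrightarrow> a \<le> w u v / m u"
    "\<And>u. (\<Sum>v\<in>{v. adj u v}. w u v / m u) \<le> D"
proof -
  obtain C where C: "C > 0" and deg: "\<And>x. real (card {y. adj x y}) \<le> C"
    and mC: "\<And>x. inverse C \<le> m x" "\<And>x. m x \<le> C"
    and wC: "\<And>x y. adj x y \<Longrightarrow> inverse C \<le> w x y" "\<And>x y. adj x y \<Longrightarrow> w x y \<le> C"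
    using assms unfolding bounded_geometry_def vertex_degree_def by blast
  show thesis
  proof
    show "0 < inverse C / C" using C by simp
    show "inverse C / C \<le> w u v / m u" if "adj u v" for u v
      using wC(1)[OF that] mC(2)[of u] m_pos[of u] w_pos[OF that] C by (intro frac_le) auto
    show "(\<Sum>v\<in>{v. adj u v}. w u v / m u) \<le> C * (C / inverse C)" for u
    proof -
      have "w u v / m u \<le> C / inverse C" if "v \<in> {v. adj u v}" for v
        using that wC(2)[of u v] mC(1)[of u] C by (intro frac_le) auto
      then have "(\<Sum>v\<in>{v. adj u v}. w u v / m u) \<le> real (card {v. adj u v}) * (C / inverse C)"
        by (rule sum_bounded_above)
      also have "\<dots> \<le> C * (C / inverse C)" using deg C by (intro mult_right_mono) auto
      finally show ?thesis .
    qed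
  qed
qed

lemma bounded_harmonic_eq_0:
  assumes geo: "bounded_geometry adj m w"
    and curv: "nonneg_curvature_outside adj m w (graph_ball adj x0 R)"
    and f: "f \<in> bounded_harmonic adj m w"
    and zero: "\<And>x. x \<in> graph_sphere adj x0 (R + 1) \<Longrightarrow> f x = 0"
    and s: "s \<in> graph_sphere adj x0 (R + 1)"
  shows "f v = 0"
proof (rule ccontr)
  assume v: "f v \<noteq> 0"
  have harm: "laplacian adj m w f x = 0" for x using f by (simp add: bounded_harmonic_def)
  obtain M where M: "\<bar>f x\<bar> \<le> M" for x
    using f by (auto simp: bounded_harmonic_def bounded_iff)
  define E where "E = (\<lambda>(x, y). f y - f x) ` {(x, y). adj x y}"
  define L where "L = Sup E"
  have "f y - f x \<le> 2 * M" for x y using M[of x] M[of y] by linarith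
  then have bdd: "bdd_above E" by (auto simp: E_def bdd_above_def)
  have L: "f y - f x \<le> L" if "adj x y" for x y
    unfolding L_def by (rule cSup_upper[OF _ bdd]) (use that in \<open>force simp: E_def\<close>)
  have "L > 0"
  proof (rule ccontr)
    assume "\<not> L > 0"
    then have edge: "f y = f x" if "adj x y" for x y
      using L[OF that] L[OF adj_sym[OF that]] by linarith
    have "f u = f s" if "adj\<^sup>*\<^sup>* s u" for u
      using that by induction (simp_all add: edge)
    then show False using adj_connected[of s v] zero[OF s] v by simp
  qed
  define h where "h v = inverse L * f v" for v
  have h_diff: "h y - h x = (f y - f x) / L" for x y
    by (simp add: h_def divide_inverse algebra_simps)
  obtain a D where aD: "0 < a" "\<And>u v. adj u v \<Longrightarrow> a \<le> w u v / m u"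
    "\<And>u. (\<Sum>v\<in>{v. adj u v}. w u v / m u) \<le> D"
    using bounded_geometry_transition_bounds[OF geo] by blast
  show False
  proof (rule no_asymptotically_steep_edges[OF _ _ _ aD])
    show "laplacian adj m w h x = 0" for x
      unfolding h_def laplacian_scale harm by simp
    show "\<bar>h x\<bar> \<le> inverse L * M" for x
      using M[of x] \<open>L > 0\<close> by (simp add: h_def abs_mult)
    show "h v - h u \<le> 1" if "adj u v" for u v
      using L[OF that] \<open>L > 0\<close> by (simp add: h_diff)
    show "0 \<le> ollivier_curvature adj m w x y" if xy: "adj x y" and pos: "0 < h y - h x" for x y
    proof -
      have ball: "f u = 0" if "u \<in> graph_ball adj x0 (R + 1)" for u
        by (rule harmonic_zero_ball[OF harm zero s that])
      have sub: "graph_ball adj x0 R \<subseteq> graph_ball adj x0 (R + 1)"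
        by (auto simp: graph_ball_def)
      have "f x \<noteq> f y" using pos by (auto simp: h_diff)
      then have "x \<notin> graph_ball adj x0 R" "y \<notin> graph_ball adj x0 R"
        using ball sub graph_ball_adj[OF xy] graph_ball_adj[OF adj_sym[OF xy]] by (metis subsetD)+
      then show ?thesis using curv xy by (simp add: nonneg_curvature_outside_def)
    qed
    show "\<exists>x y. adj x y \<and> 1 - \<epsilon> \<le> h y - h x" if "0 < \<epsilon>" for \<epsilon>
    proof -
      have "E \<noteq> {}"
      proof
        assume "E = {}"
        then have "\<not> adj x y" for x y by (auto simp: E_def)
        then have "s = v" using adj_connected[of s v] by (metis converse_rtranclpE)
        then show False using zero[OF s] v by simp
      qed
      moreover have "(1 - \<epsilon>) * L < L" using that \<open>L > 0\<close> by simp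
      ultimately obtain x y where xy: "adj x y" "(1 - \<epsilon>) * L < f y - f x"
        using less_cSup_iff[OF _ bdd] unfolding L_def by (auto simp: E_def)
      then have "1 - \<epsilon> \<le> h y - h x"
        using \<open>L > 0\<close> by (simp add: h_diff pos_le_divide_eq)
      then show ?thesis using xy(1) by blast
    qed
  qed
qed

end

section \<open>Dimension and restriction to a finite set\<close>

lemma dim_le_card_of_determining_set:
  fixes H :: "('a \<Rightarrow> real) set"
  assumes H: "rfun.subspace H" and S: "finite S"
    and det: "\<And>f. f \<in> H \<Longrightarrow> (\<And>x. x \<in> S \<Longrightarrow> f x = 0) \<Longrightarrow> f = 0"
  shows "finite_dimensional H \<and> rfun.dim H \<le> card S"
proof -
  obtain B where B: "B \<subseteq> H" "rfun.independent B" "H \<subseteq> rfun.span B" "card B = rfun.dim H"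
    by (rule rfun.basis_exists)
  have span: "rfun.span B = H"
    using B(1,3) rfun.span_minimal[OF B(1) H] by auto
  define r :: "('a \<Rightarrow> real) \<Rightarrow> 'a \<Rightarrow> real" where "r f = (\<lambda>x. if x \<in> S then f x else 0)" for f
  interpret r: Vector_Spaces.linear fun_scale fun_scale r
    by unfold_locales (auto simp: r_def fun_scale_def fun_eq_iff)
  have inj: "inj_on r (rfun.span B)"
    unfolding span r.inj_on_iff_eq_0[OF H]
  proof (intro ballI impI)
    fix f assume "f \<in> H" "r f = 0"
    moreover have "f x = 0" if "x \<in> S" for x
      using fun_cong[OF \<open>r f = 0\<close>, of x] that by (simp add: r_def)
    ultimately show "f = 0" by (intro det)
  qed
  have indep: "rfun.independent (r ` B)"
    by (rule r.independent_injective_image[OF B(2) inj])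
  define e :: "'a \<Rightarrow> 'a \<Rightarrow> real" where "e s = (\<lambda>x. if x = s then 1 else 0)" for s
  have "(\<Sum>s\<in>T. fun_scale (f s) (e s)) = (\<lambda>x. if x \<in> T then f x else 0)"
    if "finite T" for f T
    using that by induction (auto simp: e_def fun_scale_def fun_eq_iff)
  from this[OF S] have "r f = (\<Sum>s\<in>S. fun_scale (f s) (e s))" for f
    by (simp add: r_def)
  then have "r f \<in> rfun.span (e ` S)" for f
    by (simp add: rfun.span_sum rfun.span_scale rfun.span_base)
  then have "finite (r ` B) \<and> card (r ` B) \<le> card (e ` S)"
    by (intro rfun.independent_span_bound[OF _ indep]) (use S in auto)
  moreover have "inj_on r B" using inj rfun.span_superset inj_on_subset by blast
  ultimately have "finite B" "card B \<le> card S"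
    using card_image_le[OF S, of e] by (auto simp: card_image dest: finite_imageD)
  then show ?thesis using B(4) span by (auto simp: finite_dimensional_def)
qed

theorem theorem1p3:
  fixes adj :: "'a \<Rightarrow> 'a \<Rightarrow> bool" and m :: "'a \<Rightarrow> real" and w :: "'a \<Rightarrow> 'a \<Rightarrow> real"
    and x0 :: 'a and R0 :: nat
  assumes "weighted_graph adj m w"
    and "bounded_geometry adj m w"
    and "nonneg_curvature_outside adj m w (graph_ball adj x0 R0)"
    and "graph_sphere adj x0 (R0 + 1) \<noteq> {}"
  shows "finite_dimensional (bounded_harmonic adj m w)
       \<and> rfun.dim (bounded_harmonic adj m w) \<le> card (graph_sphere adj x0 (R0 + 1))
       \<and> finite (graph_sphere adj x0 (R0 + 1))"
proof -
  interpret weighted_graph adj m w by (rule assms(1))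
  obtain s where s: "s \<in> graph_sphere adj x0 (R0 + 1)" using assms(4) by blast
  have "f = 0" if "f \<in> bounded_harmonic adj m w"
    "\<And>x. x \<in> graph_sphere adj x0 (R0 + 1) \<Longrightarrow> f x = 0" for f
    using bounded_harmonic_eq_0[OF assms(2,3) that s] by (simp add: fun_eq_iff)
  then show ?thesis
    using dim_le_card_of_determining_set[OF subspace_bounded_harmonic finite_graph_sphere]
      finite_graph_sphere by blast
qed

end
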